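(* Let $\omega=(\omega_i)_{i\ge1}$ be a sequence of positive reals with $\sum_{i=1}^\infty\omega_i\le 1$, let $f:\mathbb{N}\to\mathbb{N}$ be a monotonically increasing computable function with $f(n)\to\infty$, and let $\hat K$ be a computable approximation of the prefix-free Kolmogorov complexity $K$ as described in the context. For a binary word $x_1\ldots x_n$ put $$\tau_K(x_1\ldots x_n)=\max_{m=1,\ldots,n}\big(m-\hat K(f(n),x|_1^m)-\log(1/\omega_m)\big),$$ and consider the test which, for $\alpha\in(0,1)$, rejects $H_0$ on $x_1\ldots x_n$ if and only if $\tau_K(x_1\ldots x_n)\ge\log(1/\alpha)$. Let $x=x_1x_2\ldots\in\{0,1\}^\infty$ be a sequence such that $$\liminf_{n\to\infty}\big(n-K(x|_1^n)-\log(1/\omega_n)\big)=\infty.$$ Then this test is consistent for $x$; that is, for every $\alpha\in(0,1)$ there is $n^*$ such that $H_0$ is rejected on $x_1\ldots x_n$ for all $n>n^*$.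
   Context: Logarithms are to base 2. For $x=x_1x_2\ldots\in\{0,1\}^\infty$, $x|_1^m=x_1\ldots x_m$; likewise for finite words of length at least $m$. $K$ is prefix-free Kolmogorov complexity: $K(s)$ is the length of a shortest program outputting $s$ on a fixed optimal universal prefix-free Turing machine. $\hat K:\mathbb{N}\times\{0,1\}^*\to\{1,2,\ldots\}$ is a fixed computable function such that for all integers $n$ and binary words $v$: $\hat K(n,v)\ge\hat K(n+1,v)$, $\lim_{n\to\infty}\hat K(n,v)=K(v)$, and for every $n$ the values $\hat K(n,v)$, $v\in\{0,1\}^*$, are the codeword lengths of a prefix-free code (so that $\sum_v 2^{-\hat K(n,v)}\le 1$). $H_0$ is the hypothesis that the infinite sequence $x$ is algorithmically random, i.e. there is a constant $c$ with $K(x|_1^n)\ge n-c$ for all $n$. The parameter $\alpha\in(0,1)$ is the significance level of the test. A test is consistent for $x$ if for every significance level $\alpha\in(0,1)$ the hypothesis $H_0$ is rejected on $x_1\ldots x_n$ for all $n$ from some point on. *)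

theory Defs
  imports Complex_Main "HOL-Library.Sublist" "HOL-Library.Extended_Real"
begin

text \<open>
  Computability is expressed by mu-recursive terms with a big-step semantics.
  The terms carry no arity: applied to argument lists of a fixed length \<open>k\<close>, they compute exactly
  the \<open>k\<close>-ary partial recursive functions, i.e. the partial functions computed by Turing machines.
\<close>

datatype recf = Zero | Succ | Proj nat | Comp recf "recf list" | PrimRec recf recf | Mu recf

inductive rec_eval :: "recf \<Rightarrow> nat list \<Rightarrow> nat \<Rightarrow> bool" where
  zero: "rec_eval Zero xs 0"
| succ: "rec_eval Succ [n] (Suc n)"
| proj: "i < length xs \<Longrightarrow> rec_eval (Proj i) xs (xs ! i)"
| comp: "list_all2 (\<lambda>g y. rec_eval g xs y) gs ys \<Longrightarrow> rec_eval h ys z \<Longrightarrow>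
    rec_eval (Comp h gs) xs z"
| prim_0: "rec_eval g xs y \<Longrightarrow> rec_eval (PrimRec g h) (0 # xs) y"
| prim_Suc: "rec_eval (PrimRec g h) (n # xs) y \<Longrightarrow> rec_eval h (n # y # xs) z \<Longrightarrow>
    rec_eval (PrimRec g h) (Suc n # xs) z"
| mu: "rec_eval g (n # xs) 0 \<Longrightarrow> \<forall>i<n. \<exists>y. rec_eval g (i # xs) (Suc y) \<Longrightarrow>
    rec_eval (Mu g) xs n"

type_synonym word = "bool list"

text \<open>The bijective base-2 numbering of binary words.\<close>

fun word_code :: "word \<Rightarrow> nat" where
  "word_code [] = 0"
| "word_code (b # w) = 2 * word_code w + (if b then 2 else 1)"

lemma word_code_inject: "word_code v = word_code w \<longleftrightarrow> v = w"
proof (induction v arbitrary: w)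
  case Nil
  then show ?case by (cases w) auto
next
  case (Cons b v)
  show ?case
  proof (cases w)
    case (Cons c u)
    then show ?thesis using Cons.IH[of u] by (auto split: if_splits)
  qed auto
qed

definition computable_nat :: "(nat \<Rightarrow> nat) \<Rightarrow> bool" where
  "computable_nat f \<longleftrightarrow> (\<exists>r. \<forall>n y. rec_eval r [n] y \<longleftrightarrow> y = f n)"

definition computable_nat_word :: "(nat \<Rightarrow> word \<Rightarrow> nat) \<Rightarrow> bool" where
  "computable_nat_word F \<longleftrightarrow>
    (\<exists>r. \<forall>n v y. rec_eval r [n, word_code v] y \<longleftrightarrow> y = F n v)"

definition partial_computable :: "(word \<rightharpoonup> word) \<Rightarrow> bool" where
  "partial_computable M \<longleftrightarrow>
    (\<exists>r. \<forall>p y. rec_eval r [word_code p] y \<longleftrightarrow> (\<exists>s. M p = Some s \<and> y = word_code s))"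

definition prefix_free_machine :: "(word \<rightharpoonup> word) \<Rightarrow> bool" where
  "prefix_free_machine M \<longleftrightarrow> partial_computable M \<and>
    (\<forall>p\<in>dom M. \<forall>q\<in>dom M. prefix p q \<longrightarrow> p = q)"

text \<open>
  Optimality is the invariance property: up to an additive constant, \<open>U\<close> has programs at least as
  short as those of any other prefix-free machine.
\<close>

definition optimal_prefix_free_machine :: "(word \<rightharpoonup> word) \<Rightarrow> bool" where
  "optimal_prefix_free_machine U \<longleftrightarrow> prefix_free_machine U \<and>
    (\<forall>M. prefix_free_machine M \<longrightarrow>
      (\<exists>c. \<forall>p s. M p = Some s \<longrightarrow> (\<exists>q. U q = Some s \<and> length q \<le> length p + c)))"

definition prefix_complexity :: "(word \<rightharpoonup> word) \<Rightarrow> word \<Rightarrow> nat" where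
  "prefix_complexity U s = (LEAST k. \<exists>p. U p = Some s \<and> length p = k)"

definition prefix_free_code_lengths :: "(word \<Rightarrow> nat) \<Rightarrow> bool" where
  "prefix_free_code_lengths l \<longleftrightarrow>
    (\<exists>code :: word \<Rightarrow> word. (\<forall>u v. prefix (code u) (code v) \<longrightarrow> u = v) \<and>
      (\<forall>v. length (code v) = l v))"

definition complexity_approximation :: "(word \<rightharpoonup> word) \<Rightarrow> (nat \<Rightarrow> word \<Rightarrow> nat) \<Rightarrow> bool" where
  "complexity_approximation U Khat \<longleftrightarrow>
    computable_nat_word Khat \<and>
    (\<forall>n v. Khat n v \<ge> 1) \<and>
    (\<forall>n v. Khat n v \<ge> Khat (n + 1) v) \<and>
    (\<forall>v. (\<lambda>n. Khat n v) \<longlonglongrightarrow> prefix_complexity U v) \<and>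
    (\<forall>n. prefix_free_code_lengths (Khat n))"

text \<open>Sequences \<open>x\<close> and \<open>\<omega>\<close> are indexed from 1; their values at 0 are irrelevant.\<close>

definition seq_prefix :: "(nat \<Rightarrow> bool) \<Rightarrow> nat \<Rightarrow> word" where
  "seq_prefix x m = map x [1..<Suc m]"

text \<open>Only meaningful for nonempty \<open>w\<close>, as the maximum ranges over \<open>1, \<dots>, length w\<close>.\<close>

definition tau_K :: "(nat \<Rightarrow> word \<Rightarrow> nat) \<Rightarrow> (nat \<Rightarrow> nat) \<Rightarrow> (nat \<Rightarrow> real) \<Rightarrow> word \<Rightarrow> real" where
  "tau_K Khat f \<omega> w =
    Max ((\<lambda>m. real m - real (Khat (f (length w)) (take m w)) - log 2 (1 / \<omega> m)) ` {1..length w})"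

text \<open>A test maps a significance level and an observed word to the decision to reject.\<close>

type_synonym test = "real \<Rightarrow> word \<Rightarrow> bool"

definition tau_test :: "(nat \<Rightarrow> word \<Rightarrow> nat) \<Rightarrow> (nat \<Rightarrow> nat) \<Rightarrow> (nat \<Rightarrow> real) \<Rightarrow> test" where
  "tau_test Khat f \<omega> \<alpha> w \<longleftrightarrow> tau_K Khat f \<omega> w \<ge> log 2 (1 / \<alpha>)"

definition consistent_for :: "test \<Rightarrow> (nat \<Rightarrow> bool) \<Rightarrow> bool" where
  "consistent_for T x \<longleftrightarrow>
    (\<forall>\<alpha>. 0 < \<alpha> \<and> \<alpha> < 1 \<longrightarrow> (\<exists>n0. \<forall>n>n0. T \<alpha> (seq_prefix x n)))"

end

theory Submission imports Defs begin

text \<open>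
  A single prefix suffices. Its deficiency can be taken to exceed \<open>log (1/\<alpha>)\<close>; as the
  approximation is integer valued, it equals \<open>K\<close> on this prefix from some stage on.
  Since \<open>f(n)\<close> tends to infinity, that stage is reached, and the prefix then bounds the maximum
  \<open>\<tau>\<^sub>K\<close> from below.
\<close>

lemma length_seq_prefix [simp]: "length (seq_prefix x n) = n"
  by (simp add: seq_prefix_def)

lemma take_seq_prefix: "m \<le> n \<Longrightarrow> take m (seq_prefix x n) = seq_prefix x m"
  by (simp add: seq_prefix_def take_map take_upt del: upt_Suc)

lemma tau_K_ge:
  assumes "1 \<le> m" "m \<le> length w"
  shows "real m - real (Khat (f (length w)) (take m w)) - log 2 (1 / \<omega> m) \<le> tau_K Khat f \<omega> w"
  unfolding tau_K_def using assms by (intro Max_ge) auto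

text \<open>The naturals are discrete, so convergence means reaching the limit and staying there;
  the stage depends on \<open>v\<close>.\<close>

lemma complexity_approximation_eventually_eq:
  assumes "complexity_approximation U Khat"
  shows "\<forall>\<^sub>F n in sequentially. Khat n v = prefix_complexity U v"
  using assms unfolding complexity_approximation_def by (auto simp: tendsto_discrete)

theorem theorem2:
  fixes U :: "word \<rightharpoonup> word"
    and Khat :: "nat \<Rightarrow> word \<Rightarrow> nat"
    and f :: "nat \<Rightarrow> nat"
    and \<omega> :: "nat \<Rightarrow> real"
    and x :: "nat \<Rightarrow> bool"
  assumes "optimal_prefix_free_machine U"
    and "complexity_approximation U Khat"
    and "\<forall>i\<ge>1. \<omega> i > 0"
    and "summable (\<lambda>i. \<omega> (Suc i))"
    and "(\<Sum>i. \<omega> (Suc i)) \<le> 1"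
    and "mono f"
    and "computable_nat f"
    and "filterlim f at_top at_top"
    and "liminf (\<lambda>n. ereal (real n - real (prefix_complexity U (seq_prefix x n))
                              - log 2 (1 / \<omega> n))) = \<infinity>"
  shows "consistent_for (tau_test Khat f \<omega>) x"
  unfolding consistent_for_def
proof (intro allI impI)
  fix \<alpha> :: real
  let ?d = "\<lambda>n. real n - real (prefix_complexity U (seq_prefix x n)) - log 2 (1 / \<omega> n)"
  have "\<forall>\<^sub>F n in sequentially. ereal (log 2 (1 / \<alpha>)) < ereal (?d n)"
    using assms(9) by (intro less_LiminfD) simp
  \<comment> \<open>Length 0 must be excluded, since the maximum in \<open>tau_K\<close> starts at
    1.\<close>
  then have "\<forall>\<^sub>F n in sequentially. log 2 (1 / \<alpha>) < ?d n \<and> 1 \<le> n"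
    using eventually_ge_at_top[of 1] by eventually_elim simp
  then obtain m where m: "log 2 (1 / \<alpha>) < ?d m" "1 \<le> m"
    using eventually_happens by fastforce
  \<comment> \<open>With \<open>m\<close> fixed before \<open>n\<close> grows, pointwise convergence
    of \<open>Khat\<close> is enough; no uniformity over words is required.\<close>
  have "\<forall>\<^sub>F n in sequentially. Khat (f n) (seq_prefix x m) = prefix_complexity U (seq_prefix x m)"
    by (rule eventually_compose_filterlim[OF complexity_approximation_eventually_eq[OF assms(2)] assms(8)])
  \<comment> \<open>Once n \<ge> m, the chosen prefix is an initial part of the observed word, and
    its term, now exactly \<open>?d m\<close>, enters the maximum.\<close>
  then have "\<forall>\<^sub>F n in sequentially. tau_test Khat f \<omega> \<alpha> (seq_prefix x n)"
    using eventually_ge_at_top[of m]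
  proof eventually_elim
    case (elim n)
    then show ?case
      using tau_K_ge[of m "seq_prefix x n" Khat f \<omega>] m
      by (simp add: tau_test_def take_seq_prefix)
  qed
  then show "\<exists>n0. \<forall>n>n0. tau_test Khat f \<omega> \<alpha> (seq_prefix x n)"
    unfolding eventually_sequentially by (meson less_imp_le)
qed

end
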